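(* Let $\nabla$ be the contact triad connection of the contact triad $(Q,\lambda,J)$. Then for any diffeomorphism $\phi:Q\to Q$, the pull-back connection $\phi^*\nabla$ is the contact triad connection associated to the triad $(Q,\phi^*\lambda,\phi^*J)$.
   Context: $Q$ is a smooth manifold of dimension $2n+1$ with contact form $\lambda$ (i.e. $\lambda\wedge(d\lambda)^n$ is nowhere zero) and $\xi=\ker\lambda$. The Reeb vector field $X_\lambda$ is the unique vector field with $\lambda(X_\lambda)=1$ and $d\lambda(X_\lambda,\cdot)=0$; then $TQ=\mathbb{R}\{X_\lambda\}\oplus\xi$ and $\pi:TQ\to\xi$ is the corresponding projection. A contact triad $(Q,\lambda,J)$ consists of such data with an endomorphism $J:\xi\to\xi$, $J^2=-\mathrm{id}_\xi$, compatible with $d\lambda$: $d\lambda(JY,JZ)=d\lambda(Y,Z)$ for $Y,Z\in\xi$ and $d\lambda(Y,JY)>0$ for $0\ne Y\in\xi$. $J$ is extended to $TQ$ by $JX_\lambda=0$. The contact triad metric is $g(h,k)=\lambda(h)\lambda(k)+d\lambda(\pi h,J\pi k)$. The contact triad connection of $(Q,\lambda,J)$ is the unique affine connection $\nabla$ on $Q$ (torsion $T(X,Y)=\nabla_XY-\nabla_YX-[X,Y]$) such that: (1) $\nabla g=0$; (2) $T(X_\lambda,Y)=0$ for all $Y\in TQ$; (3) $\nabla_{X_\lambda}X_\lambda=0$ and $\nabla_YX_\lambda\in\xi$ for $Y\in\xi$; (4) $\nabla^\pi:=\pi\nabla|_\xi$ is a Hermitian connection of the bundle $\xi\to Q$ with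 Hermitian structure $(d\lambda,J)$, i.e. it commutes with $J$ and preserves $g|_\xi$ (differentiating in all directions of $TQ$); (5) $\pi T(JY,Y)=0$ for all $Y\in\xi$; (6) $\nabla_{JY}X_\lambda+J\nabla_YX_\lambda=0$ for all $Y\in\xi$. Pull-backs: $\phi^*J=(d\phi)^{-1}\circ J\circ d\phi$ and $(\phi^*\nabla)_XY=\phi_*^{-1}\left(\nabla_{\phi_*X}\phi_*Y\right)$; the contact distribution of the pulled-back triad is $\ker\phi^*\lambda$. *)

theory Defs
  imports
    "HOL-Analysis.Analysis"
    "HOL-Combinatorics.Permutations"
    "HOL-Library.Function_Algebras"
begin

section \<open>Smooth manifolds\<close>

text \<open>Differentiability of class \<open>C\<^sup>k\<close> and \<open>C\<^sup>\<infinity>\<close> on an open subset of a Euclidean space.\<close>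

primrec Ck_on :: "nat \<Rightarrow> 'e::euclidean_space set \<Rightarrow> ('e \<Rightarrow> 'f::real_normed_vector) \<Rightarrow> bool" where
  "Ck_on 0 S f \<longleftrightarrow> continuous_on S f"
| "Ck_on (Suc k) S f \<longleftrightarrow>
     (\<forall>x\<in>S. f differentiable (at x)) \<and> (\<forall>v. Ck_on k S (\<lambda>x. frechet_derivative f (at x) v))"

definition smooth_on :: "'e::euclidean_space set \<Rightarrow> ('e \<Rightarrow> 'f::real_normed_vector) \<Rightarrow> bool" where
  "smooth_on S f \<longleftrightarrow> (\<forall>k. Ck_on k S f)"

text \<open>
  A manifold is a whole type of class \<open>t2_space\<close> and \<open>second_countable_topology\<close> together with
  an atlas. A chart is a pair \<open>(U, x)\<close>; the coordinate map \<open>x\<close> is relevant on \<open>U\<close> only.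
\<close>

type_synonym ('a, 'e) atlas = "('a set \<times> ('a \<Rightarrow> 'e)) set"

definition smooth_manifold ::
  "('a::{t2_space,second_countable_topology}, 'e::euclidean_space) atlas \<Rightarrow> bool" where
  "smooth_manifold A \<longleftrightarrow>
     (\<Union>(U, x)\<in>A. U) = UNIV \<and>
     (\<forall>(U, x)\<in>A. open U \<and> open (x ` U) \<and> homeomorphism U (x ` U) x (inv_into U x)) \<and>
     (\<forall>(U, x)\<in>A. \<forall>(V, y)\<in>A. smooth_on (x ` (U \<inter> V)) (y \<circ> inv_into U x))"

definition smooth_funs :: "('a::topological_space, 'e::euclidean_space) atlas \<Rightarrow> ('a \<Rightarrow> real) set" where
  "smooth_funs A = {f. \<forall>(U, x)\<in>A. smooth_on (x ` U) (f \<circ> inv_into U x)}"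

definition smooth_map ::
  "('a::topological_space, 'e::euclidean_space) atlas \<Rightarrow> ('a \<Rightarrow> 'a) \<Rightarrow> bool" where
  "smooth_map A \<phi> \<longleftrightarrow> continuous_on UNIV \<phi> \<and>
     (\<forall>(U, x)\<in>A. \<forall>(V, y)\<in>A. smooth_on (x ` (U \<inter> \<phi> -` V)) (y \<circ> \<phi> \<circ> inv_into U x))"

definition diffeomorphism ::
  "('a::topological_space, 'e::euclidean_space) atlas \<Rightarrow> ('a \<Rightarrow> 'a) \<Rightarrow> bool" where
  "diffeomorphism A \<phi> \<longleftrightarrow> bij \<phi> \<and> smooth_map A \<phi> \<and> smooth_map A (inv \<phi>)"


section \<open>Tangent vectors and vector fields\<close>

text \<open>
  The tangent space at \<open>p\<close> consists of the derivations at \<open>p\<close> of the algebra of smooth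
  functions. Tangent vectors are made to vanish on non-smooth functions, so that equality of
  derivations is equality of HOL functions. Addition, zero, subtraction and negation of tangent
  vectors and of vector fields are the pointwise ones.
\<close>

type_synonym 'a tvec = "('a \<Rightarrow> real) \<Rightarrow> real"
type_synonym 'a vfield = "'a \<Rightarrow> 'a tvec"

definition tangent_space ::
  "('a::topological_space, 'e::euclidean_space) atlas \<Rightarrow> 'a \<Rightarrow> 'a tvec set" where
  "tangent_space A p = {v.
     (\<forall>f. f \<notin> smooth_funs A \<longrightarrow> v f = 0) \<and>
     (\<forall>f\<in>smooth_funs A. \<forall>g\<in>smooth_funs A. v (\<lambda>q. f q + g q) = v f + v g) \<and>
     (\<forall>c. \<forall>f\<in>smooth_funs A. v (\<lambda>q. c * f q) = c * v f) \<and>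
     (\<forall>f\<in>smooth_funs A. \<forall>g\<in>smooth_funs A. v (\<lambda>q. f q * g q) = f p * v g + g p * v f)}"

definition tscale :: "real \<Rightarrow> 'a tvec \<Rightarrow> 'a tvec" where
  "tscale c v = (\<lambda>f. c * v f)"

definition fscale :: "('a \<Rightarrow> real) \<Rightarrow> 'a vfield \<Rightarrow> 'a vfield" where
  "fscale h X = (\<lambda>p. tscale (h p) (X p))"

definition vector_fields ::
  "('a::topological_space, 'e::euclidean_space) atlas \<Rightarrow> 'a vfield set" where
  "vector_fields A = {X. (\<forall>p. X p \<in> tangent_space A p) \<and>
     (\<forall>f\<in>smooth_funs A. (\<lambda>p. X p f) \<in> smooth_funs A)}"

definition lie_bracket :: "'a vfield \<Rightarrow> 'a vfield \<Rightarrow> 'a vfield" where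
  "lie_bracket X Y = (\<lambda>p f. X p (\<lambda>q. Y q f) - Y p (\<lambda>q. X q f))"

text \<open>
  The base point of a tangent vector is not part of the encoding, so the differential does not
  take it as an argument; its inverse does.
\<close>

definition differential ::
  "('a::topological_space, 'e::euclidean_space) atlas \<Rightarrow> ('a \<Rightarrow> 'a) \<Rightarrow> 'a tvec \<Rightarrow> 'a tvec" where
  "differential A \<phi> v = (\<lambda>f. if f \<in> smooth_funs A then v (f \<circ> \<phi>) else 0)"

definition differential_inv ::
  "('a::topological_space, 'e::euclidean_space) atlas \<Rightarrow> ('a \<Rightarrow> 'a) \<Rightarrow> 'a \<Rightarrow> 'a tvec \<Rightarrow> 'a tvec" where
  "differential_inv A \<phi> p = inv_into (tangent_space A p) (differential A \<phi>)"


section \<open>Differential forms and contact forms\<close>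

type_synonym 'a form1 = "'a \<Rightarrow> 'a tvec \<Rightarrow> real"
type_synonym 'a endo = "'a \<Rightarrow> 'a tvec \<Rightarrow> 'a tvec"

definition one_form ::
  "('a::topological_space, 'e::euclidean_space) atlas \<Rightarrow> 'a form1 \<Rightarrow> bool" where
  "one_form A lam \<longleftrightarrow>
     (\<forall>p. \<forall>u\<in>tangent_space A p. \<forall>v\<in>tangent_space A p. lam p (u + v) = lam p u + lam p v) \<and>
     (\<forall>p c. \<forall>u\<in>tangent_space A p. lam p (tscale c u) = c * lam p u) \<and>
     (\<forall>X\<in>vector_fields A. (\<lambda>p. lam p (X p)) \<in> smooth_funs A)"

text \<open>
  The exterior derivative of a 1-form by the invariant formula
  \<open>d\<lambda>(X, Y) = X(\<lambda>(Y)) - Y(\<lambda>(X)) - \<lambda>([X, Y])\<close>. The right-hand side at \<open>p\<close> depends on \<open>X\<close> and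
  \<open>Y\<close> only through their values at \<open>p\<close>, and every tangent vector extends to a vector field;
  hence the value on \<open>u, v\<close> is the common value over all extensions.
\<close>

definition ext_deriv ::
  "('a::topological_space, 'e::euclidean_space) atlas \<Rightarrow> 'a form1 \<Rightarrow> 'a \<Rightarrow> 'a tvec \<Rightarrow> 'a tvec \<Rightarrow> real" where
  "ext_deriv A lam p u v = (THE c. \<forall>X\<in>vector_fields A. \<forall>Y\<in>vector_fields A.
     X p = u \<and> Y p = v \<longrightarrow>
     c = X p (\<lambda>q. lam q (Y q)) - Y p (\<lambda>q. lam q (X q)) - lam p (lie_bracket X Y p))"

text \<open>
  A \<open>k\<close>-form at a point is a function of a sequence of tangent vectors that looks at the entries
  with index \<open>< k\<close> only.
\<close>

definition wedge ::
  "nat \<Rightarrow> nat \<Rightarrow> ((nat \<Rightarrow> 'a tvec) \<Rightarrow> real) \<Rightarrow> ((nat \<Rightarrow> 'a tvec) \<Rightarrow> real) \<Rightarrow> (nat \<Rightarrow> 'a tvec) \<Rightarrow> real" where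
  "wedge k l \<alpha> \<beta> = (\<lambda>v. (\<Sum>\<sigma> | \<sigma> permutes {..<k + l}.
     of_int (sign \<sigma>) * \<alpha> (\<lambda>i. v (\<sigma> i)) * \<beta> (\<lambda>i. v (\<sigma> (k + i)))) / (fact k * fact l))"

primrec wedge_power ::
  "nat \<Rightarrow> ((nat \<Rightarrow> 'a tvec) \<Rightarrow> real) \<Rightarrow> nat \<Rightarrow> (nat \<Rightarrow> 'a tvec) \<Rightarrow> real" where
  "wedge_power k \<alpha> 0 = (\<lambda>v. 1)"
| "wedge_power k \<alpha> (Suc m) = wedge k (k * m) \<alpha> (wedge_power k \<alpha> m)"

definition contact_form ::
  "('a::topological_space, 'e::euclidean_space) atlas \<Rightarrow> nat \<Rightarrow> 'a form1 \<Rightarrow> bool" where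
  "contact_form A n lam \<longleftrightarrow> one_form A lam \<and>
     (\<forall>p. \<exists>v. (\<forall>i. v i \<in> tangent_space A p) \<and>
        wedge 1 (2 * n) (\<lambda>w. lam p (w 0))
          (wedge_power 2 (\<lambda>w. ext_deriv A lam p (w 0) (w 1)) n) v \<noteq> 0)"

definition contact_distribution ::
  "('a::topological_space, 'e::euclidean_space) atlas \<Rightarrow> 'a form1 \<Rightarrow> 'a \<Rightarrow> 'a tvec set" where
  "contact_distribution A lam p = {v \<in> tangent_space A p. lam p v = 0}"

definition contact_sections ::
  "('a::topological_space, 'e::euclidean_space) atlas \<Rightarrow> 'a form1 \<Rightarrow> 'a vfield set" where
  "contact_sections A lam =
     {Y \<in> vector_fields A. \<forall>p. Y p \<in> contact_distribution A lam p}"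

definition reeb_conditions ::
  "('a::topological_space, 'e::euclidean_space) atlas \<Rightarrow> 'a form1 \<Rightarrow> 'a vfield \<Rightarrow> bool" where
  "reeb_conditions A lam R \<longleftrightarrow> R \<in> vector_fields A \<and>
     (\<forall>p. lam p (R p) = 1) \<and>
     (\<forall>p. \<forall>v\<in>tangent_space A p. ext_deriv A lam p (R p) v = 0)"

definition reeb_field ::
  "('a::topological_space, 'e::euclidean_space) atlas \<Rightarrow> 'a form1 \<Rightarrow> 'a vfield \<Rightarrow> bool" where
  "reeb_field A lam R \<longleftrightarrow>
     reeb_conditions A lam R \<and> (\<forall>R'. reeb_conditions A lam R' \<longrightarrow> R' = R)"


section \<open>Contact triads\<close>

definition contact_triad ::
  "('a::{t2_space,second_countable_topology}, 'e::euclidean_space) atlas \<Rightarrow> nat \<Rightarrow>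
     'a form1 \<Rightarrow> 'a endo \<Rightarrow> bool" where
  "contact_triad A n lam J \<longleftrightarrow>
     smooth_manifold A \<and> DIM('e) = 2 * n + 1 \<and> contact_form A n lam \<and>
     (\<forall>p. \<forall>u\<in>contact_distribution A lam p. J p u \<in> contact_distribution A lam p) \<and>
     (\<forall>p. \<forall>u\<in>contact_distribution A lam p. \<forall>v\<in>contact_distribution A lam p.
        J p (u + v) = J p u + J p v) \<and>
     (\<forall>p c. \<forall>u\<in>contact_distribution A lam p. J p (tscale c u) = tscale c (J p u)) \<and>
     (\<forall>Y\<in>contact_sections A lam. (\<lambda>p. J p (Y p)) \<in> contact_sections A lam) \<and>
     (\<forall>p. \<forall>u\<in>contact_distribution A lam p. J p (J p u) = - u) \<and>
     (\<forall>p. \<forall>u\<in>contact_distribution A lam p. \<forall>v\<in>contact_distribution A lam p.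
        ext_deriv A lam p (J p u) (J p v) = ext_deriv A lam p u v) \<and>
     (\<forall>p. \<forall>u\<in>contact_distribution A lam p. u \<noteq> 0 \<longrightarrow> ext_deriv A lam p u (J p u) > 0)"

text \<open>In the following, \<open>R\<close> is the Reeb vector field of \<open>lam\<close>.\<close>

definition contact_proj :: "'a form1 \<Rightarrow> 'a vfield \<Rightarrow> 'a endo" where
  "contact_proj lam R p v = v - tscale (lam p v) (R p)"

text \<open>The endomorphism \<open>J\<close> of the contact distribution, extended to the tangent bundle by \<open>J R = 0\<close>.\<close>

definition extend_endo :: "'a form1 \<Rightarrow> 'a vfield \<Rightarrow> 'a endo \<Rightarrow> 'a endo" where
  "extend_endo lam R J p v = J p (contact_proj lam R p v)"

definition triad_metric ::
  "('a::topological_space, 'e::euclidean_space) atlas \<Rightarrow> 'a form1 \<Rightarrow> 'a endo \<Rightarrow> 'a vfield \<Rightarrow>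
     'a \<Rightarrow> 'a tvec \<Rightarrow> 'a tvec \<Rightarrow> real" where
  "triad_metric A lam J R p h k =
     lam p h * lam p k +
     ext_deriv A lam p (contact_proj lam R p h) (J p (contact_proj lam R p k))"


section \<open>Connections\<close>

text \<open>
  A connection on the bundle whose smooth sections form the module \<open>S\<close>; values outside
  vector fields and \<open>S\<close> are irrelevant.
\<close>

type_synonym 'a connection = "'a vfield \<Rightarrow> 'a vfield \<Rightarrow> 'a vfield"

definition connection_on ::
  "('a::topological_space, 'e::euclidean_space) atlas \<Rightarrow> 'a vfield set \<Rightarrow> 'a connection \<Rightarrow> bool" where
  "connection_on A S D \<longleftrightarrow>
     (\<forall>X\<in>vector_fields A. \<forall>Y\<in>S. D X Y \<in> S) \<and>
     (\<forall>X\<in>vector_fields A. \<forall>X'\<in>vector_fields A. \<forall>Y\<in>S. D (X + X') Y = D X Y + D X' Y) \<and>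
     (\<forall>f\<in>smooth_funs A. \<forall>X\<in>vector_fields A. \<forall>Y\<in>S. D (fscale f X) Y = fscale f (D X Y)) \<and>
     (\<forall>X\<in>vector_fields A. \<forall>Y\<in>S. \<forall>Y'\<in>S. D X (Y + Y') = D X Y + D X Y') \<and>
     (\<forall>f\<in>smooth_funs A. \<forall>X\<in>vector_fields A. \<forall>Y\<in>S.
        D X (fscale f Y) = fscale (\<lambda>p. X p f) Y + fscale f (D X Y))"

definition affine_connection ::
  "('a::topological_space, 'e::euclidean_space) atlas \<Rightarrow> 'a connection \<Rightarrow> bool" where
  "affine_connection A N \<longleftrightarrow> connection_on A (vector_fields A) N"

definition torsion :: "'a connection \<Rightarrow> 'a vfield \<Rightarrow> 'a vfield \<Rightarrow> 'a vfield" where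
  "torsion N X Y = N X Y - N Y X - lie_bracket X Y"

definition preserves_metric_on ::
  "('a::topological_space, 'e::euclidean_space) atlas \<Rightarrow> 'a vfield set \<Rightarrow>
     ('a \<Rightarrow> 'a tvec \<Rightarrow> 'a tvec \<Rightarrow> real) \<Rightarrow> 'a connection \<Rightarrow> bool" where
  "preserves_metric_on A S g D \<longleftrightarrow>
     (\<forall>X\<in>vector_fields A. \<forall>Y\<in>S. \<forall>Z\<in>S. \<forall>p.
        X p (\<lambda>q. g q (Y q) (Z q)) = g p (D X Y p) (Z p) + g p (Y p) (D X Z p))"

definition hermitian_connection ::
  "('a::topological_space, 'e::euclidean_space) atlas \<Rightarrow> 'a form1 \<Rightarrow> 'a endo \<Rightarrow> 'a vfield \<Rightarrow>
     'a connection \<Rightarrow> bool" where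
  "hermitian_connection A lam J R D \<longleftrightarrow>
     connection_on A (contact_sections A lam) D \<and>
     (\<forall>X\<in>vector_fields A. \<forall>Y\<in>contact_sections A lam. \<forall>p.
        D X (\<lambda>q. J q (Y q)) p = J p (D X Y p)) \<and>
     preserves_metric_on A (contact_sections A lam) (triad_metric A lam J R) D"

definition triad_connection_conditions ::
  "('a::topological_space, 'e::euclidean_space) atlas \<Rightarrow> 'a form1 \<Rightarrow> 'a endo \<Rightarrow> 'a vfield \<Rightarrow>
     'a connection \<Rightarrow> bool" where
  "triad_connection_conditions A lam J R N \<longleftrightarrow>
     affine_connection A N \<and>
     preserves_metric_on A (vector_fields A) (triad_metric A lam J R) N \<and>
     (\<forall>Y\<in>vector_fields A. torsion N R Y = 0) \<and>
     N R R = 0 \<and> (\<forall>Y\<in>contact_sections A lam. N Y R \<in> contact_sections A lam) \<and>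
     hermitian_connection A lam J R (\<lambda>X Y p. contact_proj lam R p (N X Y p)) \<and>
     (\<forall>Y\<in>contact_sections A lam. \<forall>p.
        contact_proj lam R p (torsion N (\<lambda>q. extend_endo lam R J q (Y q)) Y p) = 0) \<and>
     (\<forall>Y\<in>contact_sections A lam. \<forall>p.
        N (\<lambda>q. extend_endo lam R J q (Y q)) R p + extend_endo lam R J p (N Y R p) = 0)"

text \<open>
  \<open>N\<close> is the unique connection satisfying the above conditions; connections are compared on
  vector fields.
\<close>

definition contact_triad_connection ::
  "('a::{t2_space,second_countable_topology}, 'e::euclidean_space) atlas \<Rightarrow> nat \<Rightarrow>
     'a form1 \<Rightarrow> 'a endo \<Rightarrow> 'a connection \<Rightarrow> bool" where
  "contact_triad_connection A n lam J N \<longleftrightarrow>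
     contact_triad A n lam J \<and>
     (\<exists>R. reeb_field A lam R \<and>
        triad_connection_conditions A lam J R N \<and>
        (\<forall>N'. triad_connection_conditions A lam J R N' \<longrightarrow>
           (\<forall>X\<in>vector_fields A. \<forall>Y\<in>vector_fields A. N' X Y = N X Y)))"


section \<open>Pull-backs\<close>

definition pullback_form ::
  "('a::topological_space, 'e::euclidean_space) atlas \<Rightarrow> ('a \<Rightarrow> 'a) \<Rightarrow> 'a form1 \<Rightarrow> 'a form1" where
  "pullback_form A \<phi> lam = (\<lambda>p v. lam (\<phi> p) (differential A \<phi> v))"

definition pullback_endo ::
  "('a::topological_space, 'e::euclidean_space) atlas \<Rightarrow> ('a \<Rightarrow> 'a) \<Rightarrow> 'a endo \<Rightarrow> 'a endo" where
  "pullback_endo A \<phi> J = (\<lambda>p v. differential_inv A \<phi> p (J (\<phi> p) (differential A \<phi> v)))"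

definition pushforward ::
  "('a::topological_space, 'e::euclidean_space) atlas \<Rightarrow> ('a \<Rightarrow> 'a) \<Rightarrow> 'a vfield \<Rightarrow> 'a vfield" where
  "pushforward A \<phi> X = (\<lambda>q. differential A \<phi> (X (inv \<phi> q)))"

definition pullback_connection ::
  "('a::topological_space, 'e::euclidean_space) atlas \<Rightarrow> ('a \<Rightarrow> 'a) \<Rightarrow> 'a connection \<Rightarrow> 'a connection" where
  "pullback_connection A \<phi> N = (\<lambda>X Y p.
     differential_inv A \<phi> p (N (pushforward A \<phi> X) (pushforward A \<phi> Y) (\<phi> p)))"

end

theory Submission
  imports Defs
begin

text \<open>
  The result is an instance of naturality: the contact triad connection is characterised by
  conditions formulated in terms of the smooth structure and the triad alone, and a diffeomorphism
  preserves the first and carries the pulled-back triad to the given one.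

  The analytic input is small. A diffeomorphism permutes the smooth functions by
  precomposition (\<open>smooth_funs_compose\<close>, by the chain rule for \<open>C\<^sup>k\<close> maps). As tangent vectors are
  derivations of this algebra, \<open>v \<mapsto> (\<lambda>f. v (f \<circ> \<phi>))\<close> maps tangent spaces bijectively to tangent
  spaces and induces a bijection of the vector fields that respects sums, multiplication by
  functions and Lie brackets. The exterior derivative is given by the invariant formula, which only
  uses derivatives and brackets, and so is natural as well (\<open>ext_deriv_related\<close>). From this follow in
  turn the naturality of the contact condition, of the contact distribution, of the Reeb field, of
  the projection along it and of the triad metric.

  Instead of working with the pull-back operations, the proof considers two sets of data that are
  related by \<open>\<phi>\<close>. This relation is symmetric under exchanging \<open>\<phi>\<close> with its inverse, so that one
  transport lemma (\<open>triad_connection_conditions_related\<close>) has two uses. Applied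
  along \<open>\<phi>\<close>, it shows that the pulled-back connection satisfies the defining conditions. Applied along
  \<open>inv \<phi>\<close>, it turns any other connection that satisfies the conditions for the pulled-back triad into one
  that satisfies those for the original triad; uniqueness there gives uniqueness here.
\<close>

section \<open>Calculus of \<open>C\<^sup>k\<close> maps\<close>

lemma Ck_on_cong:
  fixes f g :: "'e::euclidean_space \<Rightarrow> 'f::real_normed_vector"
  assumes "Ck_on k S f" "open S" "\<And>x. x \<in> S \<Longrightarrow> f x = g x"
  shows "Ck_on k S g"
  using assms(1,3)
proof (induction k arbitrary: f g)
  case 0
  then show ?case using continuous_on_cong[of S S f g] by simp
next
  case (Suc k)
  have der: "(g has_derivative frechet_derivative f (at x)) (at x)" if "x \<in> S" for x
    using Suc.prems that assms(2)
    by (auto intro: has_derivative_transform_within_open simp: frechet_derivative_works)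
  have "frechet_derivative g (at x) = frechet_derivative f (at x)" if "x \<in> S" for x
    using frechet_derivative_at[OF der[OF that]] by simp
  then have "Ck_on k S (\<lambda>x. frechet_derivative g (at x) v)" for v
    using Suc.IH[of "\<lambda>x. frechet_derivative f (at x) v" "\<lambda>x. frechet_derivative g (at x) v"] Suc.prems(1)
    by simp
  then show ?case using der by (auto simp: differentiable_def)
qed

text \<open>Membership in \<open>C\<^sup>k\<close> may be tested on neighbourhoods because derivatives are taken in the full
  space, not within the set. This is what allows a composite to be examined on pieces that a
  single target chart can see.\<close>

lemma Ck_on_local:
  fixes f :: "'e::euclidean_space \<Rightarrow> 'f::real_normed_vector"
  assumes "\<And>x. x \<in> S \<Longrightarrow> \<exists>T. open T \<and> x \<in> T \<and> Ck_on k T f"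
  shows "Ck_on k S f"
  using assms
proof (induction k arbitrary: f)
  case 0
  then show ?case
    by (auto intro!: continuous_at_imp_continuous_on) (metis continuous_on_eq_continuous_at)
next
  case (Suc k)
  then show ?case by (fastforce intro!: Suc.IH)
qed

lemma Ck_on_SucD: "Ck_on (Suc k) S f \<Longrightarrow> Ck_on k S f"
proof (induction k arbitrary: f)
  case 0
  then show ?case by (auto intro!: continuous_at_imp_continuous_on differentiable_imp_continuous_within)
next
  case (Suc k)
  then show ?case by (metis Ck_on.simps(2))
qed

lemma Ck_on_add:
  fixes f g :: "'e::euclidean_space \<Rightarrow> 'f::real_normed_vector"
  assumes "Ck_on k S f" "Ck_on k S g" "open S"
  shows "Ck_on k S (\<lambda>x. f x + g x)"
  using assms(1,2)
proof (induction k arbitrary: f g)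
  case 0
  then show ?case by (simp add: continuous_on_add)
next
  case (Suc k)
  have der: "((\<lambda>x. f x + g x) has_derivative
      (\<lambda>v. frechet_derivative f (at x) v + frechet_derivative g (at x) v)) (at x)"
    if "x \<in> S" for x
    using Suc.prems that
    by (intro has_derivative_add) (auto simp: frechet_derivative_works[symmetric])
  have "Ck_on k S (\<lambda>x. frechet_derivative (\<lambda>x. f x + g x) (at x) v)" for v
  proof (rule Ck_on_cong)
    show "Ck_on k S (\<lambda>x. frechet_derivative f (at x) v + frechet_derivative g (at x) v)"
      using Suc.prems by (intro Suc.IH) auto
    show "frechet_derivative f (at x) v + frechet_derivative g (at x) v =
      frechet_derivative (\<lambda>x. f x + g x) (at x) v" if "x \<in> S" for x
      using frechet_derivative_at[OF der[OF that]] by metis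
  qed fact
  then show ?case using der by (auto simp: differentiable_def)
qed

lemma Ck_on_const: "Ck_on k S (\<lambda>x. c)"
  by (induction k arbitrary: c) auto

lemma Ck_on_sum:
  fixes f :: "'i \<Rightarrow> 'e::euclidean_space \<Rightarrow> 'f::real_normed_vector"
  assumes "\<And>i. i \<in> I \<Longrightarrow> Ck_on k S (f i)" "open S"
  shows "Ck_on k S (\<lambda>x. \<Sum>i\<in>I. f i x)"
  using assms by (induction I rule: infinite_finite_induct) (auto intro!: Ck_on_const Ck_on_add)

text \<open>The derivative of the product involves \<open>f\<close> and \<open>g\<close> themselves, which is why the induction
  needs that \<open>C\<^sup>k\<^sup>+\<^sup>1\<close> maps are \<open>C\<^sup>k\<close>. For real-valued \<open>g\<close> this is the ordinary product.\<close>

lemma Ck_on_scaleR: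
  fixes f :: "'e::euclidean_space \<Rightarrow> real" and g :: "'e \<Rightarrow> 'f::real_normed_vector"
  assumes "Ck_on k S f" "Ck_on k S g" "open S"
  shows "Ck_on k S (\<lambda>x. f x *\<^sub>R g x)"
  using assms(1,2)
proof (induction k arbitrary: f g)
  case 0
  then show ?case by (simp add: continuous_on_scaleR)
next
  case (Suc k)
  have der: "((\<lambda>x. f x *\<^sub>R g x) has_derivative
      (\<lambda>v. f x *\<^sub>R frechet_derivative g (at x) v + frechet_derivative f (at x) v *\<^sub>R g x)) (at x)"
    if "x \<in> S" for x
    using Suc.prems that
    by (intro has_derivative_scaleR) (auto simp: frechet_derivative_works[symmetric])
  have "Ck_on k S (\<lambda>x. frechet_derivative (\<lambda>x. f x *\<^sub>R g x) (at x) v)" for v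
  proof (rule Ck_on_cong)
    show "Ck_on k S (\<lambda>x. f x *\<^sub>R frechet_derivative g (at x) v + frechet_derivative f (at x) v *\<^sub>R g x)"
      using Suc.prems by (intro Ck_on_add Suc.IH \<open>open S\<close>) (auto intro: Ck_on_SucD simp del: Ck_on.simps, auto)
    show "f x *\<^sub>R frechet_derivative g (at x) v + frechet_derivative f (at x) v *\<^sub>R g x =
      frechet_derivative (\<lambda>x. f x *\<^sub>R g x) (at x) v" if "x \<in> S" for x
      using frechet_derivative_at[OF der[OF that]] by metis
  qed fact
  then show ?case using der by (auto simp: differentiable_def)
qed

lemma Ck_on_inner_const:
  fixes f :: "'e::euclidean_space \<Rightarrow> 'f::real_inner"
  assumes "Ck_on k S f" "open S"
  shows "Ck_on k S (\<lambda>x. f x \<bullet> b)"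
  using assms(1)
proof (induction k arbitrary: f)
  case 0
  then show ?case by (simp add: continuous_on_inner)
next
  case (Suc k)
  have der: "((\<lambda>x. f x \<bullet> b) has_derivative (\<lambda>v. frechet_derivative f (at x) v \<bullet> b)) (at x)"
    if "x \<in> S" for x
    using Suc.prems that
    by (intro has_derivative_inner_left) (auto simp: frechet_derivative_works[symmetric])
  have "Ck_on k S (\<lambda>x. frechet_derivative (\<lambda>x. f x \<bullet> b) (at x) v)" for v
  proof (rule Ck_on_cong[OF Suc.IH \<open>open S\<close>])
    show "Ck_on k S (\<lambda>x. frechet_derivative f (at x) v)"
      using Suc.prems by auto
    show "frechet_derivative f (at x) v \<bullet> b = frechet_derivative (\<lambda>x. f x \<bullet> b) (at x) v"
      if "x \<in> S" for x
      using frechet_derivative_at[OF der[OF that]] by metis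
  qed
  then show ?case using der by (auto simp: differentiable_def)
qed

text \<open>Expanding \<open>Dg(x) v\<close> in the standard basis turns the chain rule into a finite sum of products of
  the scalar functions \<open>x \<mapsto> Dg(x) v \<bullet> b\<close> and the composites \<open>x \<mapsto> Df(g x) b\<close>, in which each partial
  derivative of \<open>f\<close> has a fixed direction \<open>b\<close>. The induction hypothesis applies to these composites,
  while it could not be applied to a direction that varies with \<open>x\<close>.\<close>

lemma Ck_on_compose:
  fixes g :: "'d::euclidean_space \<Rightarrow> 'e::euclidean_space" and f :: "'e \<Rightarrow> 'f::real_normed_vector"
  assumes "Ck_on k S g" "Ck_on k T f" "open S" "g ` S \<subseteq> T"
  shows "Ck_on k S (\<lambda>x. f (g x))"
  using assms(1,2)
proof (induction k arbitrary: f)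
  case 0
  then show ?case using assms(4) by (auto intro: continuous_on_compose2)
next
  case (Suc k)
  have der: "((\<lambda>x. f (g x)) has_derivative
      (\<lambda>v. frechet_derivative f (at (g x)) (frechet_derivative g (at x) v))) (at x)"
    if "x \<in> S" for x
  proof -
    have "(f has_derivative frechet_derivative f (at (g x))) (at (g x))"
      using Suc.prems that assms(4) by (auto simp: frechet_derivative_works[symmetric])
    moreover have "(g has_derivative frechet_derivative g (at x)) (at x)"
      using Suc.prems that by (auto simp: frechet_derivative_works[symmetric])
    ultimately show ?thesis
      using diff_chain_at[of g _ x f] by (simp add: o_def)
  qed
  have expand: "(\<Sum>b\<in>Basis. (frechet_derivative g (at x) v \<bullet> b) *\<^sub>R frechet_derivative f (at (g x)) b)
      = frechet_derivative (\<lambda>x. f (g x)) (at x) v" if "x \<in> S" for x v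
  proof -
    have "linear (frechet_derivative f (at (g x)))"
      using Suc.prems that assms(4) by (intro linear_frechet_derivative) auto
    then have "frechet_derivative f (at (g x)) (\<Sum>b\<in>Basis. (w \<bullet> b) *\<^sub>R b)
      = (\<Sum>b\<in>Basis. (w \<bullet> b) *\<^sub>R frechet_derivative f (at (g x)) b)" for w
      by (simp add: linear_sum linear_cmul)
    then show ?thesis
      using frechet_derivative_at[OF der[OF that]] by (metis euclidean_representation)
  qed
  have "Ck_on k S (\<lambda>x. frechet_derivative (\<lambda>x. f (g x)) (at x) v)" for v
  proof (rule Ck_on_cong[OF Ck_on_sum[OF Ck_on_scaleR \<open>open S\<close>] \<open>open S\<close> expand])
    show "Ck_on k S (\<lambda>x. frechet_derivative g (at x) v \<bullet> b)" for b
      using Suc.prems(1) \<open>open S\<close> by (simp add: Ck_on_inner_const)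
    show "Ck_on k S (\<lambda>x. frechet_derivative f (at (g x)) b)" for b
      using Suc.prems(2) by (intro Suc.IH Ck_on_SucD[OF Suc.prems(1)]) simp
  qed (use \<open>open S\<close> in auto)
  then show ?case using der by (auto simp: differentiable_def)
qed

section \<open>Smooth functions on a manifold\<close>

lemma smooth_funs_add:
  assumes "smooth_manifold A" "f \<in> smooth_funs A" "g \<in> smooth_funs A"
  shows "(\<lambda>q. f q + g q) \<in> smooth_funs A"
proof -
  have "Ck_on k (x ` U) ((\<lambda>q. f q + g q) \<circ> inv_into U x)" if "(U, x) \<in> A" for U x k
    using Ck_on_add[of k "x ` U" "f \<circ> inv_into U x" "g \<circ> inv_into U x"] assms that
    by (fastforce simp: smooth_manifold_def smooth_funs_def smooth_on_def o_def)
  then show ?thesis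
    by (auto simp: smooth_funs_def smooth_on_def)
qed

lemma smooth_funs_mult:
  assumes "smooth_manifold A" "f \<in> smooth_funs A" "g \<in> smooth_funs A"
  shows "(\<lambda>q. f q * g q) \<in> smooth_funs A"
proof -
  have "Ck_on k (x ` U) ((\<lambda>q. f q * g q) \<circ> inv_into U x)" if "(U, x) \<in> A" for U x k
    using Ck_on_scaleR[of k "x ` U" "f \<circ> inv_into U x" "g \<circ> inv_into U x"] assms that
    by (fastforce simp: smooth_manifold_def smooth_funs_def smooth_on_def o_def)
  then show ?thesis
    by (auto simp: smooth_funs_def smooth_on_def)
qed

text \<open>In coordinates \<open>(U, x)\<close> and \<open>(V, y)\<close> the composite factors as
  \<open>(f \<circ> y\<^sup>-\<^sup>1) \<circ> (y \<circ> \<phi> \<circ> x\<^sup>-\<^sup>1)\<close>, but only on the part of \<open>U\<close> that \<open>\<phi>\<close> sends into \<open>V\<close>. These parts are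
  open by continuity of \<open>\<phi>\<close> and cover \<open>U\<close>, and smoothness is local.\<close>

lemma smooth_funs_compose:
  assumes "smooth_manifold A" "smooth_map A \<phi>" "f \<in> smooth_funs A"
  shows "f \<circ> \<phi> \<in> smooth_funs A"
proof -
  have "Ck_on k (x ` U) (f \<circ> \<phi> \<circ> inv_into U x)" if Ux: "(U, x) \<in> A" for U x k
  proof (rule Ck_on_local)
    fix e assume "e \<in> x ` U"
    then obtain u where u: "u \<in> U" "e = x u" by auto
    have "\<phi> u \<in> (\<Union>(V, y)\<in>A. V)"
      using assms(1) by (simp add: smooth_manifold_def)
    then obtain V y where Vy: "(V, y) \<in> A" "\<phi> u \<in> V"
      by blast
    define W where "W = U \<inter> \<phi> -` V"
    have chart: "open U" "open (x ` U)" "homeomorphism U (x ` U) x (inv_into U x)" "open V"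
      using assms(1) Ux Vy by (auto simp: smooth_manifold_def)
    have "open W"
      unfolding W_def using assms(2) chart
      by (intro open_Int) (auto simp: smooth_map_def open_vimage)
    then have "openin (top_of_set U) W"
      by (auto simp: W_def openin_open)
    then have "open (x ` W)"
      using homeomorphism_imp_open_map[OF chart(3)] chart(2) openin_open_trans by blast
    have inv_x: "inv_into U x (x w) = w" if "w \<in> W" for w
      using homeomorphism_apply1[OF chart(3)] that by (simp add: W_def)
    have "homeomorphism V (y ` V) y (inv_into V y)"
      using assms(1) Vy by (auto simp: smooth_manifold_def)
    then have inv_y: "inv_into V y (y q) = q" if "q \<in> V" for q
      using homeomorphism_apply1 that by blast
    have "Ck_on k (x ` W) (\<lambda>e. (f \<circ> inv_into V y) ((y \<circ> \<phi> \<circ> inv_into U x) e))"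
    proof (rule Ck_on_compose[where f = "f \<circ> inv_into V y" and T = "y ` V"])
      show "Ck_on k (x ` W) (y \<circ> \<phi> \<circ> inv_into U x)"
        using assms(2) Ux Vy by (fastforce simp: smooth_map_def smooth_on_def W_def)
      show "Ck_on k (y ` V) (f \<circ> inv_into V y)"
        using assms(3) Vy by (fastforce simp: smooth_funs_def smooth_on_def)
      show "(y \<circ> \<phi> \<circ> inv_into U x) ` x ` W \<subseteq> y ` V"
        using inv_x by (auto simp: W_def)
    qed fact
    then have "Ck_on k (x ` W) (f \<circ> \<phi> \<circ> inv_into U x)"
    proof (rule Ck_on_cong[OF _ \<open>open (x ` W)\<close>])
      fix e' assume "e' \<in> x ` W"
      then obtain w where w: "w \<in> W" "e' = x w" by auto
      then have "\<phi> w \<in> V" by (simp add: W_def)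
      then show "(f \<circ> inv_into V y) ((y \<circ> \<phi> \<circ> inv_into U x) e') = (f \<circ> \<phi> \<circ> inv_into U x) e'"
        using w inv_x inv_y by simp
    qed
    then show "\<exists>T. open T \<and> e \<in> T \<and> Ck_on k T (f \<circ> \<phi> \<circ> inv_into U x)"
      using \<open>open (x ` W)\<close> u Vy by (intro exI[of _ "x ` W"]) (auto simp: W_def)
  qed
  then show ?thesis
    by (auto simp: smooth_funs_def smooth_on_def)
qed

section \<open>Transport of tangent vectors along a diffeomorphism\<close>

text \<open>The differential of \<open>\<phi>\<close> without its case distinction on the smoothness of \<open>f\<close>. The two agree on
  tangent vectors (\<open>differential_eq\<close> below), but this version is a linear bijection of all
  functionals, with inverse given by \<open>inv \<phi>\<close>, so that it can be moved through equations
  without any tangency side condition.\<close>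

definition push_vec :: "('a \<Rightarrow> 'a) \<Rightarrow> 'a tvec \<Rightarrow> 'a tvec" where
  "push_vec \<phi> v = (\<lambda>f. v (f \<circ> \<phi>))"

definition push_field :: "('a \<Rightarrow> 'a) \<Rightarrow> 'a vfield \<Rightarrow> 'a vfield" where
  "push_field \<phi> X = (\<lambda>q. push_vec \<phi> (X (inv \<phi> q)))"

lemma push_vec_apply: "push_vec \<phi> v h = v (h \<circ> \<phi>)"
  by (simp add: push_vec_def)

lemma push_vec_linear [simp]:
  "push_vec \<phi> (u + v) = push_vec \<phi> u + push_vec \<phi> v"
  "push_vec \<phi> (u - v) = push_vec \<phi> u - push_vec \<phi> v"
  "push_vec \<phi> (- u) = - push_vec \<phi> u"
  "push_vec \<phi> 0 = 0"
  "push_vec \<phi> (tscale c u) = tscale c (push_vec \<phi> u)"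
  by (auto simp: push_vec_def tscale_def fun_eq_iff)

lemma push_field_linear [simp]:
  "push_field \<phi> (X + Y) = push_field \<phi> X + push_field \<phi> Y"
  "push_field \<phi> (X - Y) = push_field \<phi> X - push_field \<phi> Y"
  "push_field \<phi> 0 = 0"
  by (auto simp: push_field_def fun_eq_iff push_vec_def)

lemma push_field_fscale [simp]:
  "push_field \<phi> (fscale h X) = fscale (h \<circ> inv \<phi>) (push_field \<phi> X)"
  by (auto simp: push_field_def fscale_def fun_eq_iff)

lemma tangent_space_closed:
  assumes "u \<in> tangent_space A p"
  shows "v \<in> tangent_space A p \<Longrightarrow> u + v \<in> tangent_space A p"
    and "v \<in> tangent_space A p \<Longrightarrow> u - v \<in> tangent_space A p"
    and "tscale c u \<in> tangent_space A p"
  using assms by (auto simp: tangent_space_def tscale_def algebra_simps)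

lemma vector_fields_closed:
  assumes "smooth_manifold A" "X \<in> vector_fields A"
  shows "Y \<in> vector_fields A \<Longrightarrow> X + Y \<in> vector_fields A"
    and "h \<in> smooth_funs A \<Longrightarrow> fscale h X \<in> vector_fields A"
proof -
  have "tscale c v f = c * v f" for c and v :: "'a tvec" and f
    by (simp add: tscale_def)
  then show "Y \<in> vector_fields A \<Longrightarrow> X + Y \<in> vector_fields A"
    and "h \<in> smooth_funs A \<Longrightarrow> fscale h X \<in> vector_fields A"
    using assms
    by (simp_all add: vector_fields_def fscale_def tangent_space_closed smooth_funs_add smooth_funs_mult)
qed

text \<open>By how much \<open>X Y\<close> and \<open>Y X\<close> fail the Leibniz rule is in both cases the expression
  \<open>X f \<cdot> Y g + Y f \<cdot> X g\<close>, which is symmetric in \<open>X\<close> and \<open>Y\<close>; it cancels in the commutator.\<close>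

lemma lie_bracket_tangent:
  assumes "smooth_manifold A" "X \<in> vector_fields A" "Y \<in> vector_fields A"
  shows "lie_bracket X Y p \<in> tangent_space A p"
proof -
  have supp: "v f = 0" if "v \<in> tangent_space A q" "f \<notin> smooth_funs A" for v q f
    using that by (auto simp: tangent_space_def)
  have add: "v (\<lambda>q. f q + g q) = v f + v g"
    if "v \<in> tangent_space A q" "f \<in> smooth_funs A" "g \<in> smooth_funs A" for v q f g
    using that by (auto simp: tangent_space_def)
  have scale: "v (\<lambda>q. c * f q) = c * v f"
    if "v \<in> tangent_space A q" "f \<in> smooth_funs A" for v q f c
    using that by (auto simp: tangent_space_def)
  have leibniz: "v (\<lambda>q. f q * g q) = f q * v g + g q * v f"
    if "v \<in> tangent_space A q" "f \<in> smooth_funs A" "g \<in> smooth_funs A" for v q f g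
    using that by (auto simp: tangent_space_def)
  note mult = smooth_funs_mult[OF assms(1)]
  have zero: "v (\<lambda>q. 0) = 0" if "v \<in> tangent_space A q" for v q
    using supp[OF that, of "\<lambda>q. 0"] scale[OF that, of "\<lambda>q. 0" 0] by auto
  have X: "X q \<in> tangent_space A q" "f \<in> smooth_funs A \<Longrightarrow> (\<lambda>q. X q f) \<in> smooth_funs A" for q f
    using assms(2) by (auto simp: vector_fields_def)
  have Y: "Y q \<in> tangent_space A q" "f \<in> smooth_funs A \<Longrightarrow> (\<lambda>q. Y q f) \<in> smooth_funs A" for q f
    using assms(3) by (auto simp: vector_fields_def)
  have second: "V p (\<lambda>q. W q (\<lambda>q. f q * g q)) =
      f p * V p (\<lambda>q. W q g) + W p g * V p f + (g p * V p (\<lambda>q. W q f) + W p f * V p g)"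
    if V: "V p \<in> tangent_space A p" and W: "\<And>q. W q \<in> tangent_space A q"
      "\<And>f. f \<in> smooth_funs A \<Longrightarrow> (\<lambda>q. W q f) \<in> smooth_funs A"
      and fg: "f \<in> smooth_funs A" "g \<in> smooth_funs A" for V W :: "'a vfield" and f g
  proof -
    have "V p (\<lambda>q. W q (\<lambda>q. f q * g q)) = V p (\<lambda>q. f q * W q g + g q * W q f)"
      by (simp add: leibniz[OF W(1) fg])
    also have "\<dots> = V p (\<lambda>q. f q * W q g) + V p (\<lambda>q. g q * W q f)"
      by (intro add[OF V] mult W(2) fg)
    finally show ?thesis
      by (simp add: leibniz[OF V] W(2) fg)
  qed
  show ?thesis
    unfolding tangent_space_def mem_Collect_eq lie_bracket_def
  proof (intro conjI allI ballI impI)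
    fix f :: "'a \<Rightarrow> real" assume "f \<notin> smooth_funs A"
    then show "X p (\<lambda>q. Y q f) - Y p (\<lambda>q. X q f) = 0"
      using supp[OF X(1)] supp[OF Y(1)] zero[OF X(1)] zero[OF Y(1)] by simp
  next
    fix f g assume "f \<in> smooth_funs A" "g \<in> smooth_funs A"
    then show "X p (\<lambda>q. Y q (\<lambda>q. f q + g q)) - Y p (\<lambda>q. X q (\<lambda>q. f q + g q)) =
        X p (\<lambda>q. Y q f) - Y p (\<lambda>q. X q f) + (X p (\<lambda>q. Y q g) - Y p (\<lambda>q. X q g))"
      by (simp add: add[OF X(1)] add[OF Y(1)] X(2) Y(2))
    show "X p (\<lambda>q. Y q (\<lambda>q. f q * g q)) - Y p (\<lambda>q. X q (\<lambda>q. f q * g q)) =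
        f p * (X p (\<lambda>q. Y q g) - Y p (\<lambda>q. X q g)) + g p * (X p (\<lambda>q. Y q f) - Y p (\<lambda>q. X q f))"
      using \<open>f \<in> _\<close> \<open>g \<in> _\<close>
      by (simp add: second[of X Y] second[of Y X] X Y algebra_simps)
  next
    fix c f assume "f \<in> smooth_funs A"
    then show "X p (\<lambda>q. Y q (\<lambda>q. c * f q)) - Y p (\<lambda>q. X q (\<lambda>q. c * f q)) =
        c * (X p (\<lambda>q. Y q f) - Y p (\<lambda>q. X q f))"
      by (simp add: scale[OF X(1)] scale[OF Y(1)] X(2) Y(2) algebra_simps)
  qed
qed

text \<open>Tangent vectors, vector fields, forms and connections are defined from the algebra of smooth
  functions, not from the charts. Hence the one fact about a diffeomorphism that matters for
  them is that precomposition with it permutes this algebra. The condition is symmetric in \<open>\<phi>\<close>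
  and \<open>inv \<phi>\<close>, so every inclusion below yields its converse by passing to \<open>inv \<phi>\<close>.\<close>

locale smooth_symmetry =
  fixes A :: "('a::{t2_space,second_countable_topology}, 'e::euclidean_space) atlas"
    and \<phi> :: "'a \<Rightarrow> 'a"
  assumes manifold: "smooth_manifold A"
    and bij: "bij \<phi>"
    and smooth_comp_iff: "f \<circ> \<phi> \<in> smooth_funs A \<longleftrightarrow> f \<in> smooth_funs A"
begin

lemma inv_simps [simp]: "\<phi> (inv \<phi> q) = q" "inv \<phi> (\<phi> p) = p" "inv (inv \<phi>) = \<phi>"
  using bij by (simp_all add: bij_is_surj surj_f_inv_f bij_is_inj inv_inv_eq)

lemma comp_inv_simps [simp]: "f \<circ> \<phi> \<circ> inv \<phi> = f" "f \<circ> inv \<phi> \<circ> \<phi> = f"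
  by (auto simp: fun_eq_iff)

lemma symmetry_inv: "smooth_symmetry A (inv \<phi>)"
proof
  show "f \<circ> inv \<phi> \<in> smooth_funs A \<longleftrightarrow> f \<in> smooth_funs A" for f
    using smooth_comp_iff[of "f \<circ> inv \<phi>"] by simp
qed (use manifold bij bij_imp_bij_inv in auto)

lemma push_vec_inv [simp]:
  "push_vec \<phi> (push_vec (inv \<phi>) v) = v" "push_vec (inv \<phi>) (push_vec \<phi> v) = v"
  by (simp_all add: push_vec_def)

lemma push_field_inv [simp]:
  "push_field \<phi> (push_field (inv \<phi>) X) = X" "push_field (inv \<phi>) (push_field \<phi> X) = X"
  by (simp_all add: push_field_def)

lemma push_vec_eq_iff [simp]: "push_vec \<phi> u = push_vec \<phi> v \<longleftrightarrow> u = v"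
  by (metis push_vec_inv(2))

lemma push_field_eq_iff [simp]: "push_field \<phi> X = push_field \<phi> Y \<longleftrightarrow> X = Y"
  by (metis push_field_inv(2))

lemma push_field_apply [simp]: "push_field \<phi> X (\<phi> p) = push_vec \<phi> (X p)"
  by (simp add: push_field_def)

lemma push_vec_tangent: "v \<in> tangent_space A p \<Longrightarrow> push_vec \<phi> v \<in> tangent_space A (\<phi> p)"
  using smooth_comp_iff by (simp add: tangent_space_def push_vec_def o_def)

lemma push_vec_tangent_iff [simp]:
  "push_vec \<phi> v \<in> tangent_space A (\<phi> p) \<longleftrightarrow> v \<in> tangent_space A p"
  using push_vec_tangent smooth_symmetry.push_vec_tangent[OF symmetry_inv, of "push_vec \<phi> v" "\<phi> p"]
  by auto

lemma push_vec_tangent_inv_iff: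
  "push_vec \<phi> v \<in> tangent_space A q \<longleftrightarrow> v \<in> tangent_space A (inv \<phi> q)"
  using push_vec_tangent_iff[of v "inv \<phi> q"] by simp

lemma push_field_vector_field: "X \<in> vector_fields A \<Longrightarrow> push_field \<phi> X \<in> vector_fields A"
proof -
  assume X: "X \<in> vector_fields A"
  have "(\<lambda>q. X (inv \<phi> q) (f \<circ> \<phi>)) \<in> smooth_funs A" if "f \<in> smooth_funs A" for f
    using X that smooth_comp_iff[of f] smooth_comp_iff[of "\<lambda>q. X (inv \<phi> q) (f \<circ> \<phi>)"]
    by (simp add: vector_fields_def o_def)
  then show ?thesis
    using X by (auto simp: vector_fields_def push_field_def push_vec_tangent_inv_iff)
      (simp add: push_vec_def)
qed

lemma push_field_vector_field_iff [simp]: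
  "push_field \<phi> X \<in> vector_fields A \<longleftrightarrow> X \<in> vector_fields A"
  using push_field_vector_field
    smooth_symmetry.push_field_vector_field[OF symmetry_inv, of "push_field \<phi> X"]
  by auto

text \<open>The substitution rule by which definitions that quantify over vector fields, such as that of the
  exterior derivative, are compared at \<open>p\<close> and at \<open>\<phi> p\<close>.\<close>

lemma ball_push_field:
  "(\<forall>X\<in>vector_fields A. P X) \<longleftrightarrow> (\<forall>X\<in>vector_fields A. P (push_field \<phi> X))"
  by (metis push_field_inv(1) push_field_vector_field_iff)

lemma push_field_bracket:
  "push_field \<phi> (lie_bracket X Y) = lie_bracket (push_field \<phi> X) (push_field \<phi> Y)"
  by (auto simp: push_field_def lie_bracket_def push_vec_def o_def fun_eq_iff)

text \<open>A tangent vector vanishes on non-smooth \<open>f\<close> by convention, and then \<open>f \<circ> \<phi>\<close> is non-smooth as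
  well.\<close>

lemma differential_eq: "v \<in> tangent_space A p \<Longrightarrow> differential A \<phi> v = push_vec \<phi> v"
  using smooth_comp_iff by (auto simp: differential_def push_vec_def tangent_space_def fun_eq_iff)

lemma differential_inv_tangent:
  assumes "w \<in> tangent_space A (\<phi> p)"
  shows "push_vec \<phi> (differential_inv A \<phi> p w) = w"
    and "differential_inv A \<phi> p w \<in> tangent_space A p"
proof -
  have "push_vec (inv \<phi>) w \<in> tangent_space A p"
    using assms push_vec_tangent_iff[of "push_vec (inv \<phi>) w" p] by simp
  then have w: "w \<in> differential A \<phi> ` tangent_space A p"
    using differential_eq by (intro image_eqI[where x = "push_vec (inv \<phi>) w"]) auto
  show in_T: "differential_inv A \<phi> p w \<in> tangent_space A p"
    unfolding differential_inv_def by (rule inv_into_into[OF w])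
  show "push_vec \<phi> (differential_inv A \<phi> p w) = w"
    using f_inv_into_f[OF w] differential_eq[OF in_T] by (simp add: differential_inv_def)
qed

lemma pushforward_eq: "X \<in> vector_fields A \<Longrightarrow> pushforward A \<phi> X = push_field \<phi> X"
  using differential_eq by (auto simp: pushforward_def push_field_def vector_fields_def fun_eq_iff)

end

lemma smooth_symmetry_diffeomorphism:
  assumes "smooth_manifold A" "diffeomorphism A \<phi>"
  shows "smooth_symmetry A \<phi>"
proof
  have "f \<circ> \<phi> \<circ> inv \<phi> = f" for f :: "'a \<Rightarrow> real"
    using assms(2) by (simp add: diffeomorphism_def bij_is_surj surj_f_inv_f fun_eq_iff)
  then show "f \<circ> \<phi> \<in> smooth_funs A \<longleftrightarrow> f \<in> smooth_funs A" for f
    using assms smooth_funs_compose unfolding diffeomorphism_def by metis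
qed (use assms in \<open>auto simp: diffeomorphism_def\<close>)

section \<open>Related contact data\<close>

text \<open>The pull-back is replaced by the relation of agreeing, on tangent vectors, after pushing forward.
  A relation has two advantages over the pull-back operation. It ignores junk values off
  the tangent spaces, and it is symmetric: if \<open>lam'\<close> is related to \<open>lam\<close> along \<open>\<phi>\<close>, then \<open>lam\<close> is
  related to \<open>lam'\<close> along \<open>inv \<phi>\<close>, whereas \<open>(inv \<phi>)\<^sup>*(\<phi>\<^sup>*\<lambda>)\<close> need not equal \<open>\<lambda>\<close> off the tangent
  spaces.\<close>

locale related_forms = smooth_symmetry A \<phi>
  for A :: "('a::{t2_space,second_countable_topology}, 'e::euclidean_space) atlas" and \<phi> +
  fixes lam' lam :: "'a form1"
  assumes form_related: "v \<in> tangent_space A p \<Longrightarrow> lam' p v = lam (\<phi> p) (push_vec \<phi> v)"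
begin

lemma related_forms_inv: "related_forms A (inv \<phi>) lam lam'"
proof -
  interpret inv: smooth_symmetry A "inv \<phi>" by (rule symmetry_inv)
  show ?thesis
  proof
    fix v p assume "v \<in> tangent_space A p"
    then have "push_vec (inv \<phi>) v \<in> tangent_space A (inv \<phi> p)" by simp
    then show "lam p v = lam' (inv \<phi> p) (push_vec (inv \<phi>) v)"
      using form_related by simp
  qed
qed

lemma form_push_field:
  assumes "X \<in> vector_fields A"
  shows "(\<lambda>p. lam' p (X p)) = (\<lambda>q. lam q (push_field \<phi> X q)) \<circ> \<phi>"
  using assms form_related by (auto simp: fun_eq_iff vector_fields_def)

lemma one_form_related:
  assumes "one_form A lam"
  shows "one_form A lam'"
proof -
  have "(\<lambda>p. lam' p (X p)) \<in> smooth_funs A" if "X \<in> vector_fields A" for X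
    using assms that by (simp add: form_push_field smooth_comp_iff one_form_def)
  then show ?thesis
    using assms unfolding one_form_def by (simp add: form_related tangent_space_closed)
qed

text \<open>Naturality of \<open>d\<close>. The invariant formula for vector fields \<open>X, Y\<close> at \<open>p\<close> is the one for their
  push-forwards at \<open>\<phi> p\<close>, because pushing forward respects brackets, and
  these push-forwards range over all vector fields. The two definite descriptions thus
  have the same defining predicate.\<close>

lemma ext_deriv_related:
  "ext_deriv A lam' p u v = ext_deriv A lam (\<phi> p) (push_vec \<phi> u) (push_vec \<phi> v)"
proof -
  define F where "F X Y q = X q (\<lambda>q. lam q (Y q)) - Y q (\<lambda>q. lam q (X q)) - lam q (lie_bracket X Y q)"
    for X Y q
  define F' where "F' X Y = X p (\<lambda>q. lam' q (Y q)) - Y p (\<lambda>q. lam' q (X q)) - lam' p (lie_bracket X Y p)"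
    for X Y
  have F: "F' X Y = F (push_field \<phi> X) (push_field \<phi> Y) (\<phi> p)"
    if "X \<in> vector_fields A" "Y \<in> vector_fields A" for X Y
    using that form_related[OF lie_bracket_tangent[OF manifold that]] unfolding F_def F'_def
    by (simp only: form_push_field push_field_bracket[symmetric] push_field_apply push_vec_apply)
  have "(\<forall>X\<in>vector_fields A. \<forall>Y\<in>vector_fields A. X p = u \<and> Y p = v \<longrightarrow> c = F' X Y) \<longleftrightarrow>
    (\<forall>X\<in>vector_fields A. \<forall>Y\<in>vector_fields A.
      X (\<phi> p) = push_vec \<phi> u \<and> Y (\<phi> p) = push_vec \<phi> v \<longrightarrow> c = F X Y (\<phi> p))" for c
    by (subst (3) ball_push_field, subst (4) ball_push_field) (simp add: F)
  then show ?thesis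
    unfolding ext_deriv_def F_def F'_def by simp
qed

lemma wedge_related:
  assumes "\<And>v. (\<And>i. v i \<in> tangent_space A p) \<Longrightarrow> \<alpha>' v = \<alpha> (\<lambda>i. push_vec \<phi> (v i))"
    and "\<And>v. (\<And>i. v i \<in> tangent_space A p) \<Longrightarrow> \<beta>' v = \<beta> (\<lambda>i. push_vec \<phi> (v i))"
    and "\<And>i. v i \<in> tangent_space A p"
  shows "wedge k l \<alpha>' \<beta>' v = wedge k l \<alpha> \<beta> (\<lambda>i. push_vec \<phi> (v i))"
  unfolding wedge_def using assms by simp

lemma wedge_power_related:
  assumes "\<And>v. (\<And>i. v i \<in> tangent_space A p) \<Longrightarrow> \<alpha>' v = \<alpha> (\<lambda>i. push_vec \<phi> (v i))"
    and "\<And>i. v i \<in> tangent_space A p"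
  shows "wedge_power k \<alpha>' m v = wedge_power k \<alpha> m (\<lambda>i. push_vec \<phi> (v i))"
  using assms(2)
proof (induction m arbitrary: v)
  case (Suc m)
  then show ?case
    using wedge_related[of p \<alpha>' \<alpha> "wedge_power k \<alpha>' m" "wedge_power k \<alpha> m" v k "k * m"] assms(1)
    by simp
qed simp

lemma contact_form_related:
  assumes "contact_form A n lam"
  shows "contact_form A n lam'"
  unfolding contact_form_def
proof (intro conjI allI)
  show "one_form A lam'"
    using assms one_form_related by (simp add: contact_form_def)
next
  fix p
  obtain w where w: "\<And>i. w i \<in> tangent_space A (\<phi> p)" and
    nz: "wedge 1 (2 * n) (\<lambda>w. lam (\<phi> p) (w 0))
      (wedge_power 2 (\<lambda>w. ext_deriv A lam (\<phi> p) (w 0) (w 1)) n) w \<noteq> 0"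
    using assms unfolding contact_form_def by blast
  define v where "v i = push_vec (inv \<phi>) (w i)" for i
  have v: "v i \<in> tangent_space A p" for i
    using w[of i] push_vec_tangent_iff[of "v i" p] by (simp add: v_def)
  have "wedge 1 (2 * n) (\<lambda>w. lam' p (w 0))
      (wedge_power 2 (\<lambda>w. ext_deriv A lam' p (w 0) (w 1)) n) v =
    wedge 1 (2 * n) (\<lambda>w. lam (\<phi> p) (w 0))
      (wedge_power 2 (\<lambda>w. ext_deriv A lam (\<phi> p) (w 0) (w 1)) n) (\<lambda>i. push_vec \<phi> (v i))"
    by (intro wedge_related[where p = p] wedge_power_related[where p = p] v) (simp_all add: form_related ext_deriv_related)
  also have "(\<lambda>i. push_vec \<phi> (v i)) = w"
    by (simp add: v_def)
  finally show "\<exists>v. (\<forall>i. v i \<in> tangent_space A p) \<and> wedge 1 (2 * n) (\<lambda>w. lam' p (w 0))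
      (wedge_power 2 (\<lambda>w. ext_deriv A lam' p (w 0) (w 1)) n) v \<noteq> 0"
    using v nz by (intro exI[of _ v] conjI allI) (simp_all only: not_False_eq_True)
qed

lemma contact_distribution_related [simp]:
  "push_vec \<phi> v \<in> contact_distribution A lam (\<phi> p) \<longleftrightarrow> v \<in> contact_distribution A lam' p"
  using form_related by (auto simp: contact_distribution_def)

lemma contact_sections_related [simp]:
  "push_field \<phi> Y \<in> contact_sections A lam \<longleftrightarrow> Y \<in> contact_sections A lam'"
proof -
  have "(\<forall>q. push_field \<phi> Y q \<in> contact_distribution A lam q) \<longleftrightarrow>
      (\<forall>p. push_field \<phi> Y (\<phi> p) \<in> contact_distribution A lam (\<phi> p))"
    by (metis inv_simps(1))
  then show ?thesis
    by (simp add: contact_sections_def)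
qed

lemma reeb_conditions_related:
  assumes "reeb_conditions A lam (push_field \<phi> R)"
  shows "reeb_conditions A lam' R"
proof -
  have "R \<in> vector_fields A" "lam (\<phi> p) (push_field \<phi> R (\<phi> p)) = 1"
    "w \<in> tangent_space A (\<phi> p) \<Longrightarrow> ext_deriv A lam (\<phi> p) (push_field \<phi> R (\<phi> p)) w = 0" for p w
    using assms by (simp_all add: reeb_conditions_def del: push_field_apply)
  then show ?thesis
    by (auto simp: reeb_conditions_def form_related ext_deriv_related vector_fields_def)
qed

lemma reeb_conditions_push_field_iff:
  "reeb_conditions A lam (push_field \<phi> R) \<longleftrightarrow> reeb_conditions A lam' R"
  using reeb_conditions_related
    related_forms.reeb_conditions_related[OF related_forms_inv, of "push_field \<phi> R"] by auto

lemma reeb_field_related: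
  assumes "reeb_field A lam R"
  shows "reeb_field A lam' (push_field (inv \<phi>) R)"
  using assms reeb_conditions_push_field_iff[of "push_field (inv \<phi>) R"] reeb_conditions_push_field_iff
  unfolding reeb_field_def by (metis push_field_inv)

end


text \<open>The relation between \<open>J'\<close> and \<open>J\<close> is required on the contact distribution only, since a triad does
  not constrain its endomorphism elsewhere.\<close>

locale related_triads = related_forms A \<phi> lam' lam
  for A :: "('a::{t2_space,second_countable_topology}, 'e::euclidean_space) atlas"
    and \<phi> and lam' lam :: "'a form1" +
  fixes n :: nat and J' J :: "'a endo"
  assumes triad: "contact_triad A n lam J"
    and endo_related:
      "v \<in> contact_distribution A lam' p \<Longrightarrow> push_vec \<phi> (J' p v) = J (\<phi> p) (push_vec \<phi> v)"
begin

lemma endo_distribution: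
  assumes "v \<in> contact_distribution A lam' p"
  shows "J' p v \<in> contact_distribution A lam' p"
proof -
  have "push_vec \<phi> (J' p v) \<in> contact_distribution A lam (\<phi> p)"
    using assms triad by (simp add: endo_related contact_triad_def)
  then show ?thesis by simp
qed

lemma endo_push_field:
  assumes "Y \<in> contact_sections A lam'"
  shows "push_field \<phi> (\<lambda>p. J' p (Y p)) = (\<lambda>q. J q (push_field \<phi> Y q))"
proof
  fix q
  have "Y (inv \<phi> q) \<in> contact_distribution A lam' (inv \<phi> q)"
    using assms by (simp add: contact_sections_def)
  then show "push_field \<phi> (\<lambda>p. J' p (Y p)) q = J q (push_field \<phi> Y q)"
    using endo_related by (simp add: push_field_def)
qed

lemma contact_distribution_closed:
  assumes "u \<in> contact_distribution A lam' p"
  shows "v \<in> contact_distribution A lam' p \<Longrightarrow> u + v \<in> contact_distribution A lam' p"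
    and "tscale c u \<in> contact_distribution A lam' p"
proof -
  have "one_form A lam'"
    using triad one_form_related by (simp add: contact_triad_def contact_form_def)
  then show "v \<in> contact_distribution A lam' p \<Longrightarrow> u + v \<in> contact_distribution A lam' p"
    and "tscale c u \<in> contact_distribution A lam' p"
    using assms by (auto simp: contact_distribution_def one_form_def tangent_space_closed)
qed

text \<open>Every axiom is an equation, inequality or membership that \<open>\<phi>\<close> translates into the same axiom for
  \<open>(lam, J)\<close> at \<open>\<phi> p\<close>; injectivity of the push-forward brings equations back.\<close>

lemma contact_triad_related: "contact_triad A n lam' J'"
proof -
  note T = triad[unfolded contact_triad_def]
  note rel = contact_distribution_closed endo_distribution endo_related ext_deriv_related
  have "J' p (u + v) = J' p u + J' p v"
    if "u \<in> contact_distribution A lam' p" "v \<in> contact_distribution A lam' p" for p u v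
  proof -
    have "push_vec \<phi> (J' p (u + v)) = push_vec \<phi> (J' p u + J' p v)"
      using that T by (simp add: rel del: push_vec_eq_iff)
    then show ?thesis by (simp only: push_vec_eq_iff push_vec_linear[symmetric])
  qed
  moreover have "J' p (tscale c u) = tscale c (J' p u)"
    if "u \<in> contact_distribution A lam' p" for p u c
  proof -
    have "push_vec \<phi> (J' p (tscale c u)) = push_vec \<phi> (tscale c (J' p u))"
      using that T by (simp add: rel del: push_vec_eq_iff)
    then show ?thesis by (simp only: push_vec_eq_iff push_vec_linear[symmetric])
  qed
  moreover have "J' p (J' p u) = - u" if "u \<in> contact_distribution A lam' p" for p u
  proof -
    have "push_vec \<phi> (J' p (J' p u)) = push_vec \<phi> (- u)"
      using that T by (simp add: rel del: push_vec_eq_iff)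
    then show ?thesis by (simp only: push_vec_eq_iff push_vec_linear[symmetric])
  qed
  moreover have "(\<lambda>p. J' p (Y p)) \<in> contact_sections A lam'" if "Y \<in> contact_sections A lam'" for Y
  proof -
    have "push_field \<phi> (\<lambda>p. J' p (Y p)) \<in> contact_sections A lam"
      using that T by (simp add: endo_push_field del: contact_sections_related)
        (simp del: contact_sections_related add: contact_sections_related[symmetric])
    then show ?thesis by simp
  qed
  moreover have "ext_deriv A lam' p (J' p u) (J' p v) = ext_deriv A lam' p u v"
    if "u \<in> contact_distribution A lam' p" "v \<in> contact_distribution A lam' p" for p u v
    using that T by (simp add: rel)
  moreover have "ext_deriv A lam' p u (J' p u) > 0"
    if "u \<in> contact_distribution A lam' p" "u \<noteq> 0" for p u
    using that T push_vec_eq_iff[of u 0] by (simp add: rel del: push_vec_eq_iff)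
  moreover have "smooth_manifold A" "DIM('e) = 2 * n + 1" "contact_form A n lam'"
    using T contact_form_related by auto
  ultimately show ?thesis
    unfolding contact_triad_def using endo_distribution by blast
qed

lemma related_triads_inv: "related_triads A (inv \<phi>) lam lam' n J J'"
proof -
  interpret inv: related_forms A "inv \<phi>" lam lam' by (rule related_forms_inv)
  show ?thesis
  proof
    show "contact_triad A n lam' J'" by (rule contact_triad_related)
  next
    fix v p assume "v \<in> contact_distribution A lam p"
    then have "push_vec (inv \<phi>) v \<in> contact_distribution A lam' (inv \<phi> p)" by simp
    then have "push_vec \<phi> (J' (inv \<phi> p) (push_vec (inv \<phi>) v)) = J p v"
      using endo_related by simp
    then show "push_vec (inv \<phi>) (J p v) = J' (inv \<phi> p) (push_vec (inv \<phi>) v)"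
      by (metis push_vec_inv(2))
  qed
qed

end

section \<open>Related connections\<close>

lemma connection_onI:
  assumes "\<And>X Y. X \<in> vector_fields A \<Longrightarrow> Y \<in> S \<Longrightarrow> D X Y \<in> S"
    and "\<And>X X' Y. X \<in> vector_fields A \<Longrightarrow> X' \<in> vector_fields A \<Longrightarrow> Y \<in> S \<Longrightarrow>
      D (X + X') Y = D X Y + D X' Y"
    and "\<And>f X Y. f \<in> smooth_funs A \<Longrightarrow> X \<in> vector_fields A \<Longrightarrow> Y \<in> S \<Longrightarrow>
      D (fscale f X) Y = fscale f (D X Y)"
    and "\<And>X Y Y'. X \<in> vector_fields A \<Longrightarrow> Y \<in> S \<Longrightarrow> Y' \<in> S \<Longrightarrow> D X (Y + Y') = D X Y + D X Y'"
    and "\<And>f X Y. f \<in> smooth_funs A \<Longrightarrow> X \<in> vector_fields A \<Longrightarrow> Y \<in> S \<Longrightarrow>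
      D X (fscale f Y) = fscale (\<lambda>p. X p f) Y + fscale f (D X Y)"
  shows "connection_on A S D"
  using assms unfolding connection_on_def by blast

context smooth_symmetry
begin

text \<open>Stated for an arbitrary module of sections, so as to serve both for the affine connection on the
  tangent bundle and for its projection to the contact distribution. The Leibniz rule is preserved
  because \<open>X f\<close>, moved along \<open>\<phi>\<close>, is the derivative of \<open>f \<circ> inv \<phi>\<close> by the push-forward of \<open>X\<close>.\<close>

lemma connection_on_related:
  assumes conn: "connection_on A S D"
    and S: "\<And>Y. push_field \<phi> Y \<in> S \<longleftrightarrow> Y \<in> S'"
    and closed: "\<And>Y Y'. Y \<in> S' \<Longrightarrow> Y' \<in> S' \<Longrightarrow> Y + Y' \<in> S'"
      "\<And>h Y. h \<in> smooth_funs A \<Longrightarrow> Y \<in> S' \<Longrightarrow> fscale h Y \<in> S'"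
    and D: "\<And>X Y. X \<in> vector_fields A \<Longrightarrow> Y \<in> S' \<Longrightarrow>
      push_field \<phi> (D' X Y) = D (push_field \<phi> X) (push_field \<phi> Y)"
  shows "connection_on A S' D'"
proof -
  note closed = closed vector_fields_closed[OF manifold]
  have range: "D X Y \<in> S" if "X \<in> vector_fields A" "Y \<in> S" for X Y
    using conn that unfolding connection_on_def by blast
  have add: "D (X + X') Y = D X Y + D X' Y"
    if "X \<in> vector_fields A" "X' \<in> vector_fields A" "Y \<in> S" for X X' Y
    using conn that unfolding connection_on_def by blast
  have scale: "D (fscale f X) Y = fscale f (D X Y)"
    if "f \<in> smooth_funs A" "X \<in> vector_fields A" "Y \<in> S" for f X Y
    using conn that unfolding connection_on_def by blast
  have add': "D X (Y + Y') = D X Y + D X Y'"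
    if "X \<in> vector_fields A" "Y \<in> S" "Y' \<in> S" for X Y Y'
    using conn that unfolding connection_on_def by blast
  have leibniz: "D X (fscale f Y) = fscale (\<lambda>p. X p f) Y + fscale f (D X Y)"
    if "f \<in> smooth_funs A" "X \<in> vector_fields A" "Y \<in> S" for f X Y
    using conn that unfolding connection_on_def by blast
  have smooth_inv: "h \<circ> inv \<phi> \<in> smooth_funs A" if "h \<in> smooth_funs A" for h
    using that smooth_comp_iff[of "h \<circ> inv \<phi>"] by simp
  have eqI: "X = Y" if "push_field \<phi> X = push_field \<phi> Y" for X Y
    using that by (simp only: push_field_eq_iff)
  show ?thesis
  proof (rule connection_onI)
    fix X Y assume XY: "X \<in> vector_fields A" "Y \<in> S'"
    then have "push_field \<phi> (D' X Y) \<in> S"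
      by (simp only: D S range push_field_vector_field_iff)
    then show "D' X Y \<in> S'" using S by simp
  next
    fix X X' Y assume "X \<in> vector_fields A" "X' \<in> vector_fields A" "Y \<in> S'"
    then show "D' (X + X') Y = D' X Y + D' X' Y"
      by - (rule eqI, simp add: D S add closed del: push_field_eq_iff)
  next
    fix f X Y assume "f \<in> smooth_funs A" "X \<in> vector_fields A" "Y \<in> S'"
    then show "D' (fscale f X) Y = fscale f (D' X Y)"
      by - (rule eqI, simp add: D S scale closed smooth_inv del: push_field_eq_iff)
  next
    fix X Y Y' assume "X \<in> vector_fields A" "Y \<in> S'" "Y' \<in> S'"
    then show "D' X (Y + Y') = D' X Y + D' X Y'"
      by - (rule eqI, simp add: D S add' closed del: push_field_eq_iff)
  next
    fix f X Y assume "f \<in> smooth_funs A" "X \<in> vector_fields A" "Y \<in> S'"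
    moreover have "(\<lambda>p. X p f) \<circ> inv \<phi> = (\<lambda>q. push_field \<phi> X q (f \<circ> inv \<phi>))"
      by (simp add: push_field_def push_vec_apply fun_eq_iff)
    ultimately show "D' X (fscale f Y) = fscale (\<lambda>p. X p f) Y + fscale f (D' X Y)"
      by - (rule eqI, simp add: D S leibniz closed smooth_inv del: push_field_eq_iff)
  qed
qed

lemma preserves_metric_on_related:
  assumes pres: "preserves_metric_on A S g D"
    and S: "\<And>Y. push_field \<phi> Y \<in> S \<longleftrightarrow> Y \<in> S'"
    and tangent: "\<And>Y p. Y \<in> S' \<Longrightarrow> Y p \<in> tangent_space A p"
      "\<And>X Y p. X \<in> vector_fields A \<Longrightarrow> Y \<in> S' \<Longrightarrow> D' X Y p \<in> tangent_space A p"
    and D: "\<And>X Y. X \<in> vector_fields A \<Longrightarrow> Y \<in> S' \<Longrightarrow>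
      push_field \<phi> (D' X Y) = D (push_field \<phi> X) (push_field \<phi> Y)"
    and g: "\<And>p u v. u \<in> tangent_space A p \<Longrightarrow> v \<in> tangent_space A p \<Longrightarrow>
      g' p u v = g (\<phi> p) (push_vec \<phi> u) (push_vec \<phi> v)"
  shows "preserves_metric_on A S' g' D'"
  unfolding preserves_metric_on_def
proof (intro ballI allI)
  fix X Y Z p assume XYZ: "X \<in> vector_fields A" "Y \<in> S'" "Z \<in> S'"
  have "(\<lambda>q. g' q (Y q) (Z q)) = (\<lambda>q. g q (push_field \<phi> Y q) (push_field \<phi> Z q)) \<circ> \<phi>"
    using XYZ tangent g by (simp add: fun_eq_iff)
  then have "X p (\<lambda>q. g' q (Y q) (Z q)) =
      push_field \<phi> X (\<phi> p) (\<lambda>q. g q (push_field \<phi> Y q) (push_field \<phi> Z q))"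
    by (simp add: push_vec_apply)
  also have "\<dots> = g (\<phi> p) (push_field \<phi> (D' X Y) (\<phi> p)) (push_field \<phi> Z (\<phi> p))
      + g (\<phi> p) (push_field \<phi> Y (\<phi> p)) (push_field \<phi> (D' X Z) (\<phi> p))"
    using pres XYZ by (simp add: preserves_metric_on_def D S del: push_field_apply)
  also have "\<dots> = g' p (D' X Y p) (Z p) + g' p (Y p) (D' X Z p)"
    using XYZ tangent g by simp
  finally show "X p (\<lambda>q. g' q (Y q) (Z q)) = g' p (D' X Y p) (Z p) + g' p (Y p) (D' X Z p)" .
qed

lemma torsion_related:
  assumes "push_field \<phi> (N' X Y) = N (push_field \<phi> X) (push_field \<phi> Y)"
    and "push_field \<phi> (N' Y X) = N (push_field \<phi> Y) (push_field \<phi> X)"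
  shows "push_field \<phi> (torsion N' X Y) = torsion N (push_field \<phi> X) (push_field \<phi> Y)"
  using assms by (simp add: torsion_def push_field_bracket)

end

locale related_reeb = related_triads A \<phi> lam' lam n J' J
  for A :: "('a::{t2_space,second_countable_topology}, 'e::euclidean_space) atlas"
    and \<phi> and lam' lam :: "'a form1" and n and J' J +
  fixes R' R :: "'a vfield"
  assumes reeb: "reeb_conditions A lam R"
    and reeb_related: "push_field \<phi> R' = R"
begin

lemma reeb': "reeb_conditions A lam' R'"
  using reeb reeb_related reeb_conditions_related by simp

lemma related_reeb_inv: "related_reeb A (inv \<phi>) lam lam' n J J' R R'"
proof -
  interpret inv: related_triads A "inv \<phi>" lam lam' n J J' by (rule related_triads_inv)
  show ?thesis
    by unfold_locales (use reeb' reeb_related in auto)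
qed

lemma reeb_apply: "R (\<phi> p) = push_vec \<phi> (R' p)"
  using reeb_related push_field_apply[of R' p] by simp

lemma reeb'_simps: "R' \<in> vector_fields A" "lam' p (R' p) = 1" "R' p \<in> tangent_space A p"
  using reeb' by (auto simp: reeb_conditions_def vector_fields_def)

lemma one_form': "one_form A lam'"
  using contact_triad_related by (simp add: contact_triad_def contact_form_def)

lemma proj_related:
  assumes "u \<in> tangent_space A p"
  shows "push_vec \<phi> (contact_proj lam' R' p u) = contact_proj lam R (\<phi> p) (push_vec \<phi> u)"
  using assms by (simp add: contact_proj_def form_related reeb_apply)

lemma proj_distribution:
  assumes u: "u \<in> tangent_space A p"
  shows "contact_proj lam' R' p u \<in> contact_distribution A lam' p"
proof -
  define w where "w = contact_proj lam' R' p u"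
  have w: "w \<in> tangent_space A p"
    unfolding w_def contact_proj_def using u reeb'_simps by (intro tangent_space_closed)
  \<comment> \<open>The axioms of a 1-form speak of sums, not of differences.\<close>
  have "lam' p u = lam' p (w + tscale (lam' p u) (R' p))"
    by (simp add: w_def contact_proj_def)
  also have "\<dots> = lam' p w + lam' p u"
    using one_form' w reeb'_simps by (simp add: one_form_def tangent_space_closed)
  finally show ?thesis
    using w by (simp add: contact_distribution_def w_def)
qed

lemma extend_endo_related:
  assumes "u \<in> tangent_space A p"
  shows "push_vec \<phi> (extend_endo lam' R' J' p u) = extend_endo lam R J (\<phi> p) (push_vec \<phi> u)"
  using assms by (simp add: extend_endo_def endo_related proj_distribution proj_related)

text \<open>The metric is assembled from \<open>\<lambda>\<close>, \<open>d\<lambda>\<close>, the projection and \<open>J\<close>, each of which is natural; so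
  \<open>\<phi>\<close> is an isometry between the two triad metrics.\<close>

lemma triad_metric_related:
  assumes "u \<in> tangent_space A p" "v \<in> tangent_space A p"
  shows "triad_metric A lam' J' R' p u v =
    triad_metric A lam J R (\<phi> p) (push_vec \<phi> u) (push_vec \<phi> v)"
  using assms
  by (simp add: triad_metric_def form_related ext_deriv_related endo_related proj_distribution proj_related)

lemma extend_endo_section:
  assumes "Y \<in> contact_sections A lam'"
  shows "(\<lambda>q. extend_endo lam' R' J' q (Y q)) = (\<lambda>q. J' q (Y q))"
    and "(\<lambda>q. J' q (Y q)) \<in> contact_sections A lam'"
proof -
  have "tscale 0 v = 0" for v :: "'a tvec"
    by (auto simp: tscale_def)
  then show "(\<lambda>q. extend_endo lam' R' J' q (Y q)) = (\<lambda>q. J' q (Y q))"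
    using assms
    by (auto simp: extend_endo_def contact_proj_def contact_sections_def contact_distribution_def)
  show "(\<lambda>q. J' q (Y q)) \<in> contact_sections A lam'"
    using assms contact_triad_related by (simp add: contact_triad_def)
qed

lemma extend_endo_push_field:
  assumes "Y \<in> vector_fields A"
  shows "push_field \<phi> (\<lambda>q. extend_endo lam' R' J' q (Y q)) =
    (\<lambda>q. extend_endo lam R J q (push_field \<phi> Y q))"
proof
  fix q
  have "Y (inv \<phi> q) \<in> tangent_space A (inv \<phi> q)"
    using assms by (simp add: vector_fields_def)
  then show "push_field \<phi> (\<lambda>q. extend_endo lam' R' J' q (Y q)) q =
      extend_endo lam R J q (push_field \<phi> Y q)"
    using extend_endo_related by (simp add: push_field_def)
qed

lemma contact_sections_closed:
  assumes "Y \<in> contact_sections A lam'"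
  shows "Y' \<in> contact_sections A lam' \<Longrightarrow> Y + Y' \<in> contact_sections A lam'"
    and "h \<in> smooth_funs A \<Longrightarrow> fscale h Y \<in> contact_sections A lam'"
  using assms vector_fields_closed[OF manifold] contact_distribution_closed
  by (simp_all add: contact_sections_def fscale_def[abs_def])

text \<open>Each condition asserts that some field or function built from \<open>N'\<close>, \<open>R'\<close>, \<open>J'\<close> and \<open>lam'\<close>
  vanishes or is a section of the contact distribution. Its push-forward is the corresponding
  expression for the unprimed data. The work is to check that every vector
  to which a relation is applied is tangent, respectively horizontal.\<close>

lemma triad_connection_conditions_related:
  assumes conds: "triad_connection_conditions A lam J R N"
    and N: "\<And>X Y. X \<in> vector_fields A \<Longrightarrow> Y \<in> vector_fields A \<Longrightarrow>
      push_field \<phi> (N' X Y) = N (push_field \<phi> X) (push_field \<phi> Y)"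
  shows "triad_connection_conditions A lam' J' R' N'"
proof -
  let ?p = "\<lambda>X Y p. contact_proj lam R p (N X Y p)"
  let ?p' = "\<lambda>X Y p. contact_proj lam' R' p (N' X Y p)"
  note defs = triad_connection_conditions_def hermitian_connection_def affine_connection_def
  have conn_N: "connection_on A (vector_fields A) N"
    and metric_N: "preserves_metric_on A (vector_fields A) (triad_metric A lam J R) N"
    and torsion_R: "\<And>Y. Y \<in> vector_fields A \<Longrightarrow> torsion N R Y = 0"
    and R_R: "N R R = 0"
    and Y_R: "\<And>Y. Y \<in> contact_sections A lam \<Longrightarrow> N Y R \<in> contact_sections A lam"
    and conn_p: "connection_on A (contact_sections A lam) ?p"
    and J_p: "\<And>X Y p. X \<in> vector_fields A \<Longrightarrow> Y \<in> contact_sections A lam \<Longrightarrow>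
      ?p X (\<lambda>q. J q (Y q)) p = J p (?p X Y p)"
    and metric_p: "preserves_metric_on A (contact_sections A lam) (triad_metric A lam J R) ?p"
    and torsion_J: "\<And>Y p. Y \<in> contact_sections A lam \<Longrightarrow>
      contact_proj lam R p (torsion N (\<lambda>q. extend_endo lam R J q (Y q)) Y p) = 0"
    and J_R: "\<And>Y p. Y \<in> contact_sections A lam \<Longrightarrow>
      N (\<lambda>q. extend_endo lam R J q (Y q)) R p + extend_endo lam R J p (N Y R p) = 0"
    using conds unfolding defs by blast+
  have sections: "Y \<in> vector_fields A" "Y p \<in> contact_distribution A lam' p"
    if "Y \<in> contact_sections A lam'" for Y p
    using that by (auto simp: contact_sections_def)
  have tangent: "Y p \<in> tangent_space A p" if "Y \<in> vector_fields A" for Y p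
    using that by (simp add: vector_fields_def)
  have conn: "connection_on A (vector_fields A) N'"
    by (intro connection_on_related[OF conn_N]) (simp_all add: N vector_fields_closed[OF manifold])
  then have N'_field: "N' X Y \<in> vector_fields A" if "X \<in> vector_fields A" "Y \<in> vector_fields A" for X Y
    using that by (simp add: connection_on_def)
  have proj_field: "push_field \<phi> (\<lambda>p. contact_proj lam' R' p (Z p)) =
      (\<lambda>q. contact_proj lam R q (push_field \<phi> Z q))" if "\<And>p. Z p \<in> tangent_space A p" for Z
    using that proj_related[OF that] by (simp add: push_field_def fun_eq_iff)
  have hermitian_related: "push_field \<phi> (?p' X Y) = ?p (push_field \<phi> X) (push_field \<phi> Y)"
    if "X \<in> vector_fields A" "Y \<in> vector_fields A" for X Y
    using that by (simp add: proj_field N'_field tangent N)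
  have proj_tangent: "?p' X Y p \<in> contact_distribution A lam' p"
    if "X \<in> vector_fields A" "Y \<in> vector_fields A" for X Y p
    using that by (intro proj_distribution tangent N'_field)
  have metric: "preserves_metric_on A (vector_fields A) (triad_metric A lam' J' R') N'"
    by (intro preserves_metric_on_related[OF metric_N])
      (simp_all add: N tangent N'_field triad_metric_related)
  have hermitian_conn: "connection_on A (contact_sections A lam') ?p'"
    by (intro connection_on_related[OF conn_p])
      (simp_all add: hermitian_related sections contact_sections_closed)
  have hermitian_metric:
    "preserves_metric_on A (contact_sections A lam') (triad_metric A lam' J' R') ?p'"
    using proj_tangent
    by (intro preserves_metric_on_related[OF metric_p])
      (simp_all add: hermitian_related sections tangent triad_metric_related contact_distribution_def)
  have zero_field: "Z = 0" if "push_field \<phi> Z = 0" for Z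
    using that push_field_eq_iff[of Z 0] by simp
  have "torsion N' R' Y = 0" if "Y \<in> vector_fields A" for Y
    using that reeb'_simps
    by - (rule zero_field, simp add: torsion_R torsion_related[of N' R' Y N] N reeb_related)
  moreover have "N' R' R' = 0"
    using reeb'_simps by - (rule zero_field, simp add: R_R N reeb_related)
  moreover have "N' Y R' \<in> contact_sections A lam'" if "Y \<in> contact_sections A lam'" for Y
  proof -
    have "push_field \<phi> (N' Y R') \<in> contact_sections A lam"
      using that Y_R[of "push_field \<phi> Y"] by (simp add: N reeb_related sections reeb'_simps)
    then show ?thesis by simp
  qed
  moreover have "?p' X (\<lambda>q. J' q (Y q)) p = J' p (?p' X Y p)"
    if X: "X \<in> vector_fields A" and Y: "Y \<in> contact_sections A lam'" for X Y p
  proof -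
    have JY: "(\<lambda>q. J' q (Y q)) \<in> vector_fields A"
      using extend_endo_section(2)[OF Y] sections by blast
    have "push_vec \<phi> (?p' X (\<lambda>q. J' q (Y q)) p) =
        push_field \<phi> (?p' X (\<lambda>q. J' q (Y q))) (\<phi> p)"
      by simp
    also have "\<dots> = ?p (push_field \<phi> X) (\<lambda>q. J q (push_field \<phi> Y q)) (\<phi> p)"
      by (simp only: hermitian_related[OF X JY] endo_push_field[OF Y])
    also have "\<dots> = J (\<phi> p) (?p (push_field \<phi> X) (push_field \<phi> Y) (\<phi> p))"
      using X Y by (intro J_p) simp_all
    also have "\<dots> = J (\<phi> p) (push_field \<phi> (?p' X Y) (\<phi> p))"
      using X Y by (simp only: hermitian_related sections)
    also have "\<dots> = push_vec \<phi> (J' p (?p' X Y p))"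
      using X Y by (simp add: endo_related proj_tangent sections)
    finally show ?thesis by (simp only: push_vec_eq_iff)
  qed
  moreover have "contact_proj lam' R' p (torsion N' (\<lambda>q. extend_endo lam' R' J' q (Y q)) Y p) = 0"
    if Y: "Y \<in> contact_sections A lam'" for Y p
  proof -
    let ?JY = "\<lambda>q. extend_endo lam' R' J' q (Y q)"
    have fields: "?JY \<in> vector_fields A" "Y \<in> vector_fields A"
      using extend_endo_section[OF Y] sections Y by auto
    have "torsion N' ?JY Y q \<in> tangent_space A q" for q
      using fields by (simp add: torsion_def tangent_space_closed tangent N'_field
          lie_bracket_tangent[OF manifold])
    then have "push_field \<phi> (\<lambda>p. contact_proj lam' R' p (torsion N' ?JY Y p)) = 0"
      using Y fields torsion_J[of "push_field \<phi> Y"]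
      by (simp add: proj_field torsion_related[of N' _ _ N] N extend_endo_push_field fun_eq_iff)
    from zero_field[OF this] show ?thesis by (simp add: fun_eq_iff)
  qed
  moreover have "N' (\<lambda>q. extend_endo lam' R' J' q (Y q)) R' p + extend_endo lam' R' J' p (N' Y R' p) = 0"
    if Y: "Y \<in> contact_sections A lam'" for Y p
  proof -
    let ?JY = "\<lambda>q. extend_endo lam' R' J' q (Y q)"
    have fields: "?JY \<in> vector_fields A" "Y \<in> vector_fields A"
      using extend_endo_section[OF Y] sections Y by auto
    have "push_field \<phi> (N' ?JY R' + (\<lambda>p. extend_endo lam' R' J' p (N' Y R' p))) = 0"
      using Y fields J_R[of "push_field \<phi> Y"]
      by (simp add: N N'_field reeb'_simps reeb_related extend_endo_push_field fun_eq_iff)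
    from zero_field[OF this] show ?thesis by (simp add: fun_eq_iff)
  qed
  ultimately show ?thesis
    using conn metric hermitian_conn hermitian_metric
    unfolding defs by blast
qed

end

theorem corollary1:
  fixes A :: "('a::{t2_space,second_countable_topology}, 'e::euclidean_space) atlas"
    and n :: nat
    and lam :: "'a form1" and J :: "'a endo"
    and N :: "'a connection"
    and \<phi> :: "'a \<Rightarrow> 'a"
  assumes "contact_triad_connection A n lam J N"
    and "diffeomorphism A \<phi>"
  shows "contact_triad_connection A n (pullback_form A \<phi> lam) (pullback_endo A \<phi> J)
           (pullback_connection A \<phi> N)"
proof -
  obtain R where triad: "contact_triad A n lam J" and R: "reeb_field A lam R"
    and conds: "triad_connection_conditions A lam J R N"
    and unique: "\<And>N0 X Y. triad_connection_conditions A lam J R N0 \<Longrightarrow>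
      X \<in> vector_fields A \<Longrightarrow> Y \<in> vector_fields A \<Longrightarrow> N0 X Y = N X Y"
    using assms(1) unfolding contact_triad_connection_def by blast
  let ?lam = "pullback_form A \<phi> lam" and ?J = "pullback_endo A \<phi> J"
  let ?R = "push_field (inv \<phi>) R" and ?N = "pullback_connection A \<phi> N"
  interpret smooth_symmetry A \<phi>
    using triad assms(2) by (intro smooth_symmetry_diffeomorphism) (simp_all add: contact_triad_def)
  interpret related_forms A \<phi> ?lam lam
    by unfold_locales (simp add: pullback_form_def differential_eq)
  interpret related_triads A \<phi> ?lam lam n ?J J
  proof
    fix v p assume v: "v \<in> contact_distribution A ?lam p"
    then have "J (\<phi> p) (push_vec \<phi> v) \<in> contact_distribution A lam (\<phi> p)"
      using triad by (simp add: contact_triad_def)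
    then show "push_vec \<phi> (?J p v) = J (\<phi> p) (push_vec \<phi> v)"
      using v by (simp add: pullback_endo_def differential_eq[of v p] contact_distribution_def
          differential_inv_tangent)
  qed fact
  interpret related_reeb A \<phi> ?lam lam n ?J J ?R R
    by unfold_locales (use R in \<open>simp_all add: reeb_field_def\<close>)
  interpret inv: related_reeb A "inv \<phi>" lam ?lam n J ?J R ?R
    by (rule related_reeb_inv)
  have N: "push_field \<phi> (?N X Y) = N (push_field \<phi> X) (push_field \<phi> Y)"
    if XY: "X \<in> vector_fields A" "Y \<in> vector_fields A" for X Y
  proof
    fix q
    have "N (push_field \<phi> X) (push_field \<phi> Y) \<in> vector_fields A"
      using conds XY
      by (simp add: triad_connection_conditions_def affine_connection_def connection_on_def)
    then have "N (push_field \<phi> X) (push_field \<phi> Y) q \<in> tangent_space A (\<phi> (inv \<phi> q))"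
      by (simp add: vector_fields_def)
    from differential_inv_tangent(1)[OF this]
    show "push_field \<phi> (?N X Y) q = N (push_field \<phi> X) (push_field \<phi> Y) q"
      unfolding push_field_def[of _ "?N X Y"] unfolding pullback_connection_def
      using XY by (simp add: pushforward_eq)
  qed
  have "N' X Y = ?N X Y"
    if N': "triad_connection_conditions A ?lam ?J ?R N'"
      and XY: "X \<in> vector_fields A" "Y \<in> vector_fields A" for N' X Y
  proof -
    \<comment> \<open>A competitor for the pulled-back triad, pushed forward, is a competitor for the original one.\<close>
    define N0 where "N0 X Y = push_field \<phi> (N' (push_field (inv \<phi>) X) (push_field (inv \<phi>) Y))" for X Y
    have "triad_connection_conditions A lam J R N0"
      by (rule inv.triad_connection_conditions_related[OF N']) (simp add: N0_def)
    then have "N0 (push_field \<phi> X) (push_field \<phi> Y) = N (push_field \<phi> X) (push_field \<phi> Y)"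
      using XY by (intro unique) simp_all
    then have "push_field \<phi> (N' X Y) = push_field \<phi> (?N X Y)"
      using XY by (simp add: N0_def N)
    then show ?thesis by (simp only: push_field_eq_iff)
  qed
  moreover have "triad_connection_conditions A ?lam ?J ?R ?N"
    using conds N by (rule triad_connection_conditions_related)
  ultimately show ?thesis
    unfolding contact_triad_connection_def
    using contact_triad_related reeb_field_related[OF R] by blast
qed

end
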